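(* If $\Gamma\vdash M:A$ is derivable in $\Lambda_\cap$, then $\Gamma\vdash_s M:A$ is derivable in $\Lambda_\cap^s$.
   Context: $\lambda$-terms: $M::=x\mid MM\mid\lambda x.M$ modulo $\alpha$-conversion; $M[x:=N]$ capture-avoiding substitution. Types: $A::=\varphi\mid A\to A\mid A\cap A$. A typing context is a finite set of pairs $x:A$ ($\Gamma,x:A$ denotes $\Gamma\cup\{x:A\}$; $x\notin\Gamma$ means no $x:B$ lies in $\Gamma$); in $\Lambda_\cap$ its variables are pairwise distinct, in $\Lambda_\cap^s$ a variable may occur with several types. $\Lambda_\cap$: (Ax) $\Gamma,x:A\vdash x:A$; ($\to$I) from $\Gamma,x:A\vdash M:B$, $x\notin\Gamma$, infer $\Gamma\vdash\lambda x.M:A\to B$; ($\to$E) from $\Gamma\vdash M:A\to B$ and $\Gamma\vdash N:A$ infer $\Gamma\vdash MN:B$; ($\cap$I) from $\Gamma\vdash M:A$, $\Gamma\vdash M:B$ infer $\Gamma\vdash M:A\cap B$; ($\cap$E) from $\Gamma\vdash M:A\cap B$ infer $\Gamma\vdash M:A$ and $\Gamma\vdash M:B$. $\Lambda_\cap^s$ ($n\ge0$): (Ax) $\Gamma,x:A\vdash_s x:A$; $(\mathsf{Beta})^s$ from $\Gamma\vdash_s M[x:=N]N_1\dots N_n:A$ and $\Gamma\vdash_s N:B$ infer $\Gamma\vdash_s(\lambda x.M)NN_1\dots N_n:A$; $(\mathsf{L}\to)$ from $\Gamma\vdash_s N:A_1$ and $\Gamma,y:A_2\vdash_s yN_1\dots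 N_n:B$, with $y\notin FV(N_1)\cup\dots\cup FV(N_n)$, $y\notin\Gamma$, infer $\Gamma,x:A_1\to A_2\vdash_s xNN_1\dots N_n:B$; $(\mathsf{R}\to)$ from $\Gamma,x:A\vdash_s M:B$, $x\notin\Gamma$, infer $\Gamma\vdash_s\lambda x.M:A\to B$; $(\mathsf{L}\cap)$ from $\Gamma,x:A_1,x:A_2\vdash_s xN_1\dots N_n:B$ infer $\Gamma,x:A_1\cap A_2\vdash_s xN_1\dots N_n:B$; $(\mathsf{R}\cap)$ from $\Gamma\vdash_s M:A$ and $\Gamma\vdash_s M:B$ infer $\Gamma\vdash_s M:A\cap B$. *)

theory Defs
  imports Main
begin

section \<open>Terms\<close>

text \<open>
  Terms modulo \<open>\<alpha>\<close>-conversion are the locally closed terms of the locally nameless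
  representation: free variables are named, bound ones are de Bruijn indices.  The operations
  \<open>Var\<close>, \<open>App\<close>, \<open>Lam\<close>, substitution and \<open>FV\<close> below are those of the named calculus, with
  \<open>Lam x M\<close> binding the name \<open>x\<close> in \<open>M\<close>.  That they are so is the content of \<open>Lam_alpha\<close>,
  \<open>Lam_eq_iff\<close>, \<open>subst_Lam\<close>, \<open>FV_Lam\<close> and \<open>lterm_induct\<close>.
\<close>

type_synonym var = nat

datatype pterm = BVar nat | FVar var | PApp pterm pterm | PAbs pterm

primrec lc_at :: "nat \<Rightarrow> pterm \<Rightarrow> bool" where
  "lc_at k (BVar i) = (i < k)"
| "lc_at k (FVar y) = True"
| "lc_at k (PApp s t) = (lc_at k s \<and> lc_at k t)"
| "lc_at k (PAbs t) = lc_at (Suc k) t"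

primrec pclose :: "nat \<Rightarrow> var \<Rightarrow> pterm \<Rightarrow> pterm" where
  "pclose k x (BVar i) = BVar i"
| "pclose k x (FVar y) = (if y = x then BVar k else FVar y)"
| "pclose k x (PApp s t) = PApp (pclose k x s) (pclose k x t)"
| "pclose k x (PAbs t) = PAbs (pclose (Suc k) x t)"

primrec psubst :: "pterm \<Rightarrow> var \<Rightarrow> pterm \<Rightarrow> pterm" where
  "psubst (BVar i) x u = BVar i"
| "psubst (FVar y) x u = (if y = x then u else FVar y)"
| "psubst (PApp s t) x u = PApp (psubst s x u) (psubst t x u)"
| "psubst (PAbs t) x u = PAbs (psubst t x u)"

primrec pfv :: "pterm \<Rightarrow> var set" where
  "pfv (BVar i) = {}"
| "pfv (FVar y) = {y}"
| "pfv (PApp s t) = pfv s \<union> pfv t"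
| "pfv (PAbs t) = pfv t"

lemma lc_at_mono: "lc_at k t \<Longrightarrow> k \<le> l \<Longrightarrow> lc_at l t"
  by (induction t arbitrary: k l) auto

lemma lc_at_pclose: "lc_at k t \<Longrightarrow> lc_at (Suc k) (pclose k x t)"
  by (induction t arbitrary: k) auto

lemma lc_at_psubst: "lc_at k t \<Longrightarrow> lc_at 0 u \<Longrightarrow> lc_at k (psubst t x u)"
  by (induction t arbitrary: k) (auto intro: lc_at_mono)

typedef lterm = "{t. lc_at 0 t}"
  by (rule exI[of _ "FVar 0"]) simp

setup_lifting type_definition_lterm

lift_definition Var :: "var \<Rightarrow> lterm" is FVar
  by simp

lift_definition App :: "lterm \<Rightarrow> lterm \<Rightarrow> lterm" is PApp
  by simp

lift_definition Lam :: "var \<Rightarrow> lterm \<Rightarrow> lterm" is "\<lambda>x t. PAbs (pclose 0 x t)"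
  by (simp add: lc_at_pclose)

lift_definition subst :: "lterm \<Rightarrow> var \<Rightarrow> lterm \<Rightarrow> lterm" (\<open>_[_ ::= _]\<close> [300, 0, 0] 300) is psubst
  by (rule lc_at_psubst)

lift_definition FV :: "lterm \<Rightarrow> var set" is pfv .

definition Apps :: "lterm \<Rightarrow> lterm list \<Rightarrow> lterm" where
  "Apps M Ns = foldl App M Ns"


subsection \<open>Adequacy of the representation\<close>

primrec popen :: "nat \<Rightarrow> var \<Rightarrow> pterm \<Rightarrow> pterm" where
  "popen k x (BVar i) = (if i = k then FVar x else BVar i)"
| "popen k x (FVar y) = FVar y"
| "popen k x (PApp s t) = PApp (popen k x s) (popen k x t)"
| "popen k x (PAbs t) = PAbs (popen (Suc k) x t)"

lemma finite_pfv: "finite (pfv t)"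
  by (induction t) auto

lemma lc_at_popen: "lc_at (Suc k) t \<Longrightarrow> lc_at k (popen k x t)"
  by (induction t arbitrary: k) auto

lemma pclose_popen: "x \<notin> pfv t \<Longrightarrow> pclose k x (popen k x t) = t"
  by (induction t arbitrary: k) auto

lemma popen_pclose: "lc_at k t \<Longrightarrow> popen k y (pclose k x t) = psubst t x (FVar y)"
  by (induction t arbitrary: k) auto

lemma size_popen: "size (popen k x t) = size t"
  by (induction t arbitrary: k) auto

lemma pfv_pclose: "pfv (pclose k x t) = pfv t - {x}"
  by (induction t arbitrary: k) auto

lemma psubst_same: "psubst t x (FVar x) = t"
  by (induction t) auto

lemma psubst_fresh: "x \<notin> pfv t \<Longrightarrow> psubst t x u = t"
  by (induction t) auto

lemma pclose_fresh: "x \<notin> pfv t \<Longrightarrow> pclose k x t = t"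
  by (induction t arbitrary: k) auto

lemma pclose_rename:
  "y \<notin> pfv t \<Longrightarrow> pclose k y (psubst t x (FVar y)) = pclose k x t"
  by (induction t arbitrary: k) auto

lemma psubst_pclose:
  "y \<noteq> x \<Longrightarrow> y \<notin> pfv u \<Longrightarrow> psubst (pclose k y t) x u = pclose k y (psubst t x u)"
  by (induction t arbitrary: k) (auto simp: pclose_fresh)

lemma finite_FV [simp]: "finite (FV M)"
  by transfer (rule finite_pfv)

lemma FV_Var [simp]: "FV (Var x) = {x}"
  by transfer simp

lemma FV_App [simp]: "FV (App M N) = FV M \<union> FV N"
  by transfer simp

lemma FV_Lam [simp]: "FV (Lam x M) = FV M - {x}"
  by transfer (simp add: pfv_pclose)

lemma subst_Var [simp]: "(Var y)[x ::= N] = (if y = x then N else Var y)"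
  by transfer simp

lemma subst_App [simp]: "(App M M')[x ::= N] = App (M[x ::= N]) (M'[x ::= N])"
  by transfer simp

lemma subst_Lam: "y \<noteq> x \<Longrightarrow> y \<notin> FV N \<Longrightarrow> (Lam y M)[x ::= N] = Lam y (M[x ::= N])"
  by transfer (simp add: psubst_pclose)

lemma Lam_alpha: "y \<notin> FV M \<Longrightarrow> Lam x M = Lam y (M[x ::= Var y])"
  by transfer (simp add: pclose_rename)

lemma App_eq_iff [simp]: "App M N = App M' N' \<longleftrightarrow> M = M' \<and> N = N'"
  by transfer simp

lemma Var_eq_iff [simp]: "Var x = Var y \<longleftrightarrow> x = y"
  by transfer simp

lemma lterm_distinct [simp]:
  "Var x \<noteq> App M N" "App M N \<noteq> Var x" "Var x \<noteq> Lam y M" "Lam y M \<noteq> Var x"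
  "App M N \<noteq> Lam y M'" "Lam y M' \<noteq> App M N"
  by (transfer, simp)+

lemma Lam_eq_iff:
  "Lam x M = Lam y N \<longleftrightarrow> (x = y \<or> y \<notin> FV M) \<and> N = M[x ::= Var y]"
proof transfer
  fix x y M N assume lc: "lc_at 0 M" "lc_at 0 N"
  show "PAbs (pclose 0 x M) = PAbs (pclose 0 y N) \<longleftrightarrow>
      (x = y \<or> y \<notin> pfv M) \<and> N = psubst M x (FVar y)" (is "?L \<longleftrightarrow> ?R")
  proof
    assume ?L
    then have eq: "pclose 0 x M = pclose 0 y N" by simp
    then have "popen 0 y (pclose 0 x M) = popen 0 y (pclose 0 y N)" by simp
    then have N: "N = psubst M x (FVar y)"
      using lc by (simp add: popen_pclose psubst_same)
    have "pfv M - {x} = pfv N - {y}"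
      using arg_cong[OF eq, of pfv] by (simp add: pfv_pclose)
    then have "x = y \<or> y \<notin> pfv M" by blast
    with N show ?R by simp
  next
    assume ?R
    then show ?L by (auto simp: psubst_same pclose_rename)
  qed
qed

lemma lterm_induct [case_names Var App Lam]:
  assumes fin: "finite X"
    and V: "\<And>x. P (Var x)"
    and A: "\<And>M N. P M \<Longrightarrow> P N \<Longrightarrow> P (App M N)"
    and L: "\<And>x M. x \<notin> X \<Longrightarrow> P M \<Longrightarrow> P (Lam x M)"
  shows "P M"
proof -
  have "lc_at 0 t \<Longrightarrow> P (Abs_lterm t)" for t
  proof (induction t rule: measure_induct_rule[of size])
    case (less t)
    show ?case
    proof (cases t)
      case (BVar i)
      with less.prems show ?thesis by simp
    next
      case (FVar y)
      with V[of y] show ?thesis by (simp add: Var.abs_eq Var_def)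
    next
      case (PApp s u)
      with less have "P (App (Abs_lterm s) (Abs_lterm u))" by (intro A) auto
      with PApp less.prems show ?thesis by (simp add: App.abs_eq eq_onp_def)
    next
      case (PAbs s)
      obtain x where x: "x \<notin> X \<union> pfv s"
        using ex_new_if_finite[OF infinite_UNIV_nat, of "X \<union> pfv s"] fin finite_pfv by auto
      have lc: "lc_at 0 (popen 0 x s)" using PAbs less.prems by (simp add: lc_at_popen)
      have "P (Lam x (Abs_lterm (popen 0 x s)))"
        using x lc PAbs by (intro L less.IH) (auto simp: size_popen)
      with x lc PAbs show ?thesis by (simp add: Lam.abs_eq eq_onp_def pclose_popen)
    qed
  qed
  from this[of "Rep_lterm M"] show ?thesis
    using Rep_lterm[of M] by (simp add: Rep_lterm_inverse)
qed


section \<open>Types and contexts\<close>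

text \<open>\<open>'a\<close> is the set of atomic types.\<close>

datatype 'a ty =
    Atom 'a
  | Arrow "'a ty" "'a ty" (infixr \<open>\<rightarrow>\<^sub>t\<close> 70)
  | Inter "'a ty" "'a ty" (infixr \<open>\<inter>\<^sub>t\<close> 75)

text \<open>\<open>fst ` \<Gamma>\<close> is the set of variables occurring in \<open>\<Gamma>\<close>; \<open>\<Gamma>, x : A\<close> is \<open>insert (x, A) \<Gamma>\<close>.\<close>

type_synonym 'a ctx = "(var \<times> 'a ty) set"

definition distinct_vars :: "'a ctx \<Rightarrow> bool" where
  "distinct_vars \<Gamma> \<longleftrightarrow> (\<forall>x A B. (x, A) \<in> \<Gamma> \<longrightarrow> (x, B) \<in> \<Gamma> \<longrightarrow> A = B)"


section \<open>The two systems\<close>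

text \<open>
  Contexts are finite, and in the first system their variables are pairwise distinct.  It is enough
  to demand this in the axioms, since all other rules preserve it
  (\<open>typing_ctx\<close> and \<open>typing_s_ctx\<close>).
\<close>

inductive typing :: "'a ctx \<Rightarrow> lterm \<Rightarrow> 'a ty \<Rightarrow> bool" (\<open>_ \<turnstile> _ : _\<close> [50, 50, 50] 50) where
  Ax: "finite \<Gamma> \<Longrightarrow> distinct_vars (insert (x, A) \<Gamma>) \<Longrightarrow> insert (x, A) \<Gamma> \<turnstile> Var x : A"
| ArrI: "insert (x, A) \<Gamma> \<turnstile> M : B \<Longrightarrow> x \<notin> fst ` \<Gamma> \<Longrightarrow> \<Gamma> \<turnstile> Lam x M : A \<rightarrow>\<^sub>t B"
| ArrE: "\<Gamma> \<turnstile> M : A \<rightarrow>\<^sub>t B \<Longrightarrow> \<Gamma> \<turnstile> N : A \<Longrightarrow> \<Gamma> \<turnstile> App M N : B"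
| IntI: "\<Gamma> \<turnstile> M : A \<Longrightarrow> \<Gamma> \<turnstile> M : B \<Longrightarrow> \<Gamma> \<turnstile> M : A \<inter>\<^sub>t B"
| IntE1: "\<Gamma> \<turnstile> M : A \<inter>\<^sub>t B \<Longrightarrow> \<Gamma> \<turnstile> M : A"
| IntE2: "\<Gamma> \<turnstile> M : A \<inter>\<^sub>t B \<Longrightarrow> \<Gamma> \<turnstile> M : B"

inductive typing_s :: "'a ctx \<Rightarrow> lterm \<Rightarrow> 'a ty \<Rightarrow> bool" (\<open>_ \<turnstile>\<^sub>s _ : _\<close> [50, 50, 50] 50) where
  Ax_s: "finite \<Gamma> \<Longrightarrow> insert (x, A) \<Gamma> \<turnstile>\<^sub>s Var x : A"
| Beta_s: "\<Gamma> \<turnstile>\<^sub>s Apps (M[x ::= N]) Ns : A \<Longrightarrow> \<Gamma> \<turnstile>\<^sub>s N : B \<Longrightarrow>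
    \<Gamma> \<turnstile>\<^sub>s Apps (App (Lam x M) N) Ns : A"
| L_Arr: "\<Gamma> \<turnstile>\<^sub>s N : A\<^sub>1 \<Longrightarrow> insert (y, A\<^sub>2) \<Gamma> \<turnstile>\<^sub>s Apps (Var y) Ns : B \<Longrightarrow>
    y \<notin> (\<Union>N'\<in>set Ns. FV N') \<Longrightarrow> y \<notin> fst ` \<Gamma> \<Longrightarrow>
    insert (x, A\<^sub>1 \<rightarrow>\<^sub>t A\<^sub>2) \<Gamma> \<turnstile>\<^sub>s Apps (App (Var x) N) Ns : B"
| R_Arr: "insert (x, A) \<Gamma> \<turnstile>\<^sub>s M : B \<Longrightarrow> x \<notin> fst ` \<Gamma> \<Longrightarrow> \<Gamma> \<turnstile>\<^sub>s Lam x M : A \<rightarrow>\<^sub>t B"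
| L_Int: "insert (x, A\<^sub>1) (insert (x, A\<^sub>2) \<Gamma>) \<turnstile>\<^sub>s Apps (Var x) Ns : B \<Longrightarrow>
    insert (x, A\<^sub>1 \<inter>\<^sub>t A\<^sub>2) \<Gamma> \<turnstile>\<^sub>s Apps (Var x) Ns : B"
| R_Int: "\<Gamma> \<turnstile>\<^sub>s M : A \<Longrightarrow> \<Gamma> \<turnstile>\<^sub>s M : B \<Longrightarrow> \<Gamma> \<turnstile>\<^sub>s M : A \<inter>\<^sub>t B"

lemma typing_ctx: "\<Gamma> \<turnstile> M : A \<Longrightarrow> finite \<Gamma> \<and> distinct_vars \<Gamma>"
  by (induction rule: typing.induct) (auto simp: distinct_vars_def)

lemma typing_s_ctx: "\<Gamma> \<turnstile>\<^sub>s M : A \<Longrightarrow> finite \<Gamma>"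
  by (induction rule: typing_s.induct) auto

end

theory Submission
  imports Defs
begin

text \<open>
  Types are interpreted as Kripke-style computability predicates on pairs of a context and a term,
  worlds being contexts ordered by inclusion.  Computability at an arrow type asks for
  \<open>\<turnstile>\<^sub>s\<close>-typability explicitly: it cannot be recovered from computability of the applications,
  because \<open>\<turnstile>\<^sub>s\<close> is not closed under \<open>\<eta>\<close>-reduction.  Variables are computable thanks to
  the predicate \<open>cuttable\<close>: a term of type \<open>A\<close> may replace a fresh head variable of type \<open>A\<close> in
  every typed spine.  This property is propagated through applications and projections of
  intersections by exactly the rules \<open>L_Arr\<close> and \<open>L_Int\<close>, so that no cut elimination is needed.
\<close>

section \<open>Parallel substitution\<close>

primrec pmsubst :: "(var \<Rightarrow> pterm) \<Rightarrow> pterm \<Rightarrow> pterm" where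
  "pmsubst \<sigma> (BVar i) = BVar i"
| "pmsubst \<sigma> (FVar y) = \<sigma> y"
| "pmsubst \<sigma> (PApp s t) = PApp (pmsubst \<sigma> s) (pmsubst \<sigma> t)"
| "pmsubst \<sigma> (PAbs t) = PAbs (pmsubst \<sigma> t)"

lemma lc_at_pmsubst: "lc_at k t \<Longrightarrow> (\<And>x. lc_at 0 (\<sigma> x)) \<Longrightarrow> lc_at k (pmsubst \<sigma> t)"
  by (induction t arbitrary: k) (auto intro: lc_at_mono)

text \<open>By \<open>pclose_fresh\<close>, abstracting \<open>z\<close> leaves the images of the
  other free variables alone, so the only names turned into index \<open>k\<close> are those put in
  for \<open>x\<close>.\<close>

lemma pmsubst_pclose:
  "(\<And>v. v \<in> pfv t \<Longrightarrow> v \<noteq> x \<Longrightarrow> z \<notin> pfv (\<sigma> v)) \<Longrightarrow>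
    pmsubst \<sigma> (pclose k x t) = pclose k z (pmsubst (\<sigma>(x := FVar z)) t)"
  by (induction t arbitrary: k) (auto simp: pclose_fresh)

lemma pmsubst_psubst: "pmsubst \<sigma> (psubst t x u) = pmsubst (\<sigma>(x := pmsubst \<sigma> u)) t"
  by (induction t) auto

lemma psubst_pmsubst: "psubst (pmsubst \<sigma> t) z u = pmsubst (\<lambda>v. psubst (\<sigma> v) z u) t"
  by (induction t) auto

lemma pmsubst_cong: "(\<And>v. v \<in> pfv t \<Longrightarrow> \<sigma> v = \<tau> v) \<Longrightarrow> pmsubst \<sigma> t = pmsubst \<tau> t"
  by (induction t) auto

lemma pmsubst_FVar: "pmsubst FVar t = t"
  by (induction t) auto

lift_definition msubst :: "(var \<Rightarrow> lterm) \<Rightarrow> lterm \<Rightarrow> lterm" is pmsubst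
  by (rule lc_at_pmsubst)

lemma msubst_Var [simp]: "msubst \<sigma> (Var x) = \<sigma> x"
  by transfer simp

lemma msubst_App [simp]: "msubst \<sigma> (App M N) = App (msubst \<sigma> M) (msubst \<sigma> N)"
  by transfer simp

lemma msubst_Lam:
  "(\<And>v. v \<in> FV M \<Longrightarrow> v \<noteq> x \<Longrightarrow> z \<notin> FV (\<sigma> v)) \<Longrightarrow>
    msubst \<sigma> (Lam x M) = Lam z (msubst (\<sigma>(x := Var z)) M)"
  by transfer (simp add: pmsubst_pclose)

lemma msubst_subst: "msubst \<sigma> (M[x ::= N]) = msubst (\<sigma>(x := msubst \<sigma> N)) M"
  by transfer (rule pmsubst_psubst)

lemma subst_msubst: "(msubst \<sigma> M)[z ::= N] = msubst (\<lambda>v. (\<sigma> v)[z ::= N]) M"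
  by transfer (rule psubst_pmsubst)

lemma msubst_cong: "(\<And>v. v \<in> FV M \<Longrightarrow> \<sigma> v = \<tau> v) \<Longrightarrow> msubst \<sigma> M = msubst \<tau> M"
  by transfer (rule pmsubst_cong)

lemma msubst_id: "msubst Var M = M"
  by transfer (rule pmsubst_FVar)

lemma subst_fresh: "x \<notin> FV M \<Longrightarrow> M[x ::= N] = M"
  by transfer (rule psubst_fresh)

lemma msubst_Apps: "msubst \<sigma> (Apps M Ns) = Apps (msubst \<sigma> M) (map (msubst \<sigma>) Ns)"
  unfolding Apps_def by (induction Ns arbitrary: M) auto

lemma Apps_Nil [simp]: "Apps M [] = M"
  by (simp add: Apps_def)

lemma Apps_Cons: "Apps M (N # Ns) = Apps (App M N) Ns"
  by (simp add: Apps_def)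

lemma Apps_snoc: "Apps M (Ns @ [N]) = App (Apps M Ns) N"
  by (simp add: Apps_def)

lemma ex_fresh_var:
  fixes X :: "var set"
  assumes "finite X"
  obtains z where "z \<notin> X"
  using ex_new_if_finite[OF infinite_UNIV_nat assms] by blast

text \<open>The binder is renamed to one \<open>z\<close> fresh for \<open>X\<close> and for every
  \<open>\<sigma> v\<close> with \<open>v\<close> free in \<open>M\<close>. The last equation then
  reads a beta step on the renamed abstraction as an update of \<sigma> at the old name
  \<open>x\<close>.\<close>

lemma msubst_Lam_fresh:
  assumes "finite X"
  obtains z where "z \<notin> X" "msubst \<sigma> (Lam x M) = Lam z (msubst (\<sigma>(x := Var z)) M)"
    "\<And>N. (msubst (\<sigma>(x := Var z)) M)[z ::= N] = msubst (\<sigma>(x := N)) M"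
proof -
  obtain z where z: "z \<notin> X \<union> (\<Union>v\<in>FV M. FV (\<sigma> v))"
    using assms by (rule_tac X = "X \<union> (\<Union>v\<in>FV M. FV (\<sigma> v))" in ex_fresh_var) auto
  have "(msubst (\<sigma>(x := Var z)) M)[z ::= N] = msubst (\<sigma>(x := N)) M" for N
    unfolding subst_msubst using z by (intro msubst_cong) (auto simp: subst_fresh)
  then show thesis using z by (intro that[of z] msubst_Lam) auto
qed


section \<open>Renaming and weakening\<close>

lemma typing_s_rename:
  assumes "\<Gamma> \<turnstile>\<^sub>s M : A" "finite \<Delta>" "\<And>x B. (x, B) \<in> \<Gamma> \<Longrightarrow> (\<rho> x, B) \<in> \<Delta>"
  shows "\<Delta> \<turnstile>\<^sub>s msubst (\<lambda>v. Var (\<rho> v)) M : A"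
  using assms
proof (induction arbitrary: \<Delta> \<rho> rule: typing_s.induct)
  case (Ax_s \<Gamma> x A)
  \<comment> \<open>The renamed declaration already lies in \<Delta>, so the rule applies with all
    of \<Delta> as side context. The cases of the left rules end in the same way.\<close>
  then have "insert (\<rho> x, A) \<Delta> = \<Delta>" by auto
  with typing_s.Ax_s[OF \<open>finite \<Delta>\<close>, of "\<rho> x" A] show ?case by simp
next
  case (Beta_s \<Gamma> M x N Ns A B)
  obtain z where z: "msubst (\<lambda>v. Var (\<rho> v)) (Lam x M) = Lam z (msubst ((\<lambda>v. Var (\<rho> v))(x := Var z)) M)"
    "\<And>N. (msubst ((\<lambda>v. Var (\<rho> v))(x := Var z)) M)[z ::= N] = msubst ((\<lambda>v. Var (\<rho> v))(x := N)) M"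
    by (rule msubst_Lam_fresh[OF finite.emptyI]) blast
  show ?case
    unfolding msubst_Apps msubst_App z(1)
  proof (rule typing_s.Beta_s)
    show "\<Delta> \<turnstile>\<^sub>s Apps ((msubst ((\<lambda>v. Var (\<rho> v))(x := Var z)) M)[z ::= msubst (\<lambda>v. Var (\<rho> v)) N])
        (map (msubst (\<lambda>v. Var (\<rho> v))) Ns) : A"
      using Beta_s.IH(1)[OF Beta_s.prems] unfolding z(2) msubst_Apps msubst_subst .
    show "\<Delta> \<turnstile>\<^sub>s msubst (\<lambda>v. Var (\<rho> v)) N : B"
      by (rule Beta_s.IH(2)[OF Beta_s.prems])
  qed
next
  case (L_Arr \<Gamma> N A\<^sub>1 y A\<^sub>2 Ns B x)
  let ?Ns = "map (msubst (\<lambda>v. Var (\<rho> v))) Ns"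
  \<comment> \<open>The head variable \<open>y\<close> of the premise may clash with \<Delta> or
    with the renamed arguments, so it is sent to a fresh \<open>z\<close>.\<close>
  obtain z where z: "z \<notin> fst ` \<Delta> \<union> (\<Union>N'\<in>set ?Ns. FV N')"
    using L_Arr.prems(1) by (rule_tac X = "fst ` \<Delta> \<union> (\<Union>N'\<in>set ?Ns. FV N')" in ex_fresh_var) auto
  have "insert (z, A\<^sub>2) \<Delta> \<turnstile>\<^sub>s msubst (\<lambda>v. Var ((\<rho>(y := z)) v)) (Apps (Var y) Ns) : B"
    using L_Arr.prems L_Arr.hyps(4) by (intro L_Arr.IH(2)) (auto simp: image_iff)
  moreover have "map (msubst (\<lambda>v. Var ((\<rho>(y := z)) v))) Ns = ?Ns"
    using L_Arr.hyps(3) by (auto intro!: msubst_cong)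
  ultimately have 1: "insert (z, A\<^sub>2) \<Delta> \<turnstile>\<^sub>s Apps (Var z) ?Ns : B"
    unfolding msubst_Apps by (simp only: msubst_Var fun_upd_same)
  have 2: "\<Delta> \<turnstile>\<^sub>s msubst (\<lambda>v. Var (\<rho> v)) N : A\<^sub>1"
    using L_Arr.prems by (intro L_Arr.IH(1)) auto
  have "insert (\<rho> x, A\<^sub>1 \<rightarrow>\<^sub>t A\<^sub>2) \<Delta> = \<Delta>" using L_Arr.prems(2) by auto
  with typing_s.L_Arr[OF 2 1, of "\<rho> x"] z show ?case by (simp add: msubst_Apps)
next
  case (R_Arr x A \<Gamma> M B)
  have "finite (fst ` \<Delta>)" using R_Arr.prems by simp
  then obtain z where z: "z \<notin> fst ` \<Delta>"
    "msubst (\<lambda>v. Var (\<rho> v)) (Lam x M) = Lam z (msubst ((\<lambda>v. Var (\<rho> v))(x := Var z)) M)"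
    by (rule msubst_Lam_fresh) blast
  have "insert (z, A) \<Delta> \<turnstile>\<^sub>s msubst (\<lambda>v. Var ((\<rho>(x := z)) v)) M : B"
    using R_Arr.prems R_Arr.hyps(2) by (intro R_Arr.IH) (auto simp: image_iff)
  moreover have "(\<lambda>v. Var ((\<rho>(x := z)) v)) = (\<lambda>v. Var (\<rho> v))(x := Var z)" by auto
  ultimately show ?case unfolding z(2) using z(1) by (auto intro: typing_s.R_Arr)
next
  case (L_Int x A\<^sub>1 A\<^sub>2 \<Gamma> Ns B)
  have "insert (\<rho> x, A\<^sub>1) (insert (\<rho> x, A\<^sub>2) \<Delta>) \<turnstile>\<^sub>s msubst (\<lambda>v. Var (\<rho> v)) (Apps (Var x) Ns) : B"
    using L_Int.prems by (intro L_Int.IH) auto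
  moreover have "insert (\<rho> x, A\<^sub>1 \<inter>\<^sub>t A\<^sub>2) \<Delta> = \<Delta>" using L_Int.prems(2) by auto
  ultimately show ?case using typing_s.L_Int[of "\<rho> x" A\<^sub>1 A\<^sub>2 \<Delta>] by (simp add: msubst_Apps)
next
  case (R_Int \<Gamma> M A B)
  then show ?case by (intro typing_s.R_Int) auto
qed

lemma typing_s_weaken: "\<Gamma> \<turnstile>\<^sub>s M : A \<Longrightarrow> \<Gamma> \<subseteq> \<Delta> \<Longrightarrow> finite \<Delta> \<Longrightarrow> \<Delta> \<turnstile>\<^sub>s M : A"
  using typing_s_rename[of \<Gamma> M A \<Delta> "\<lambda>v. v"] by (auto simp: msubst_id)

text \<open>Contraction of \<open>y\<close> into \<open>x\<close>, an instance of non-injective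
  renaming; the arguments do not contain \<open>y\<close> and stay fixed.\<close>

lemma typing_s_rename_head:
  assumes d: "insert (y, A) \<Gamma> \<turnstile>\<^sub>s Apps (Var y) Ns : B"
    and y: "y \<notin> (\<Union>N\<in>set Ns. FV N)" "y \<notin> fst ` \<Gamma>"
    and x: "(x, A) \<in> \<Gamma>"
  shows "\<Gamma> \<turnstile>\<^sub>s Apps (Var x) Ns : B"
proof -
  have "\<Gamma> \<turnstile>\<^sub>s msubst (\<lambda>v. Var ((id(y := x)) v)) (Apps (Var y) Ns) : B"
    using typing_s_ctx[OF d] x y(2) by (intro typing_s_rename[OF d]) (auto simp: image_iff)
  moreover have "msubst (\<lambda>v. Var ((id(y := x)) v)) N = N" if "N \<in> set Ns" for N
  proof -
    have "msubst (\<lambda>v. Var ((id(y := x)) v)) N = msubst Var N"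
      using y(1) that by (intro msubst_cong) auto
    then show ?thesis by (simp add: msubst_id)
  qed
  then have "map (msubst (\<lambda>v. Var ((id(y := x)) v))) Ns = Ns" by (rule map_idI)
  ultimately show ?thesis by (simp add: msubst_Apps)
qed


section \<open>Cuttable terms\<close>

text \<open>Admissibility of a cut at head position. Ranging over all larger \<Delta> makes the
  property monotone in the context.\<close>

definition cuttable :: "'a ctx \<Rightarrow> lterm \<Rightarrow> 'a ty \<Rightarrow> bool" where
  "cuttable \<Gamma> M A \<longleftrightarrow> (\<forall>\<Delta> Ns y B. \<Gamma> \<subseteq> \<Delta> \<longrightarrow> y \<notin> (\<Union>N\<in>set Ns. FV N) \<longrightarrow> y \<notin> fst ` \<Delta> \<longrightarrow>
    insert (y, A) \<Delta> \<turnstile>\<^sub>s Apps (Var y) Ns : B \<longrightarrow> \<Delta> \<turnstile>\<^sub>s Apps M Ns : B)"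

lemma cuttableD:
  assumes "cuttable \<Gamma> M A" "\<Gamma> \<subseteq> \<Delta>" "insert (y, A) \<Delta> \<turnstile>\<^sub>s Apps (Var y) Ns : B"
    "y \<notin> (\<Union>N\<in>set Ns. FV N)" "y \<notin> fst ` \<Delta>"
  shows "\<Delta> \<turnstile>\<^sub>s Apps M Ns : B"
  using assms unfolding cuttable_def by blast

lemma cuttable_mono: "cuttable \<Gamma> M A \<Longrightarrow> \<Gamma> \<subseteq> \<Delta> \<Longrightarrow> cuttable \<Delta> M A"
  unfolding cuttable_def by (meson order_trans)

lemma cuttable_Var: "(x, A) \<in> \<Gamma> \<Longrightarrow> cuttable \<Gamma> (Var x) A"
  unfolding cuttable_def by (blast intro: typing_s_rename_head)

lemma cuttable_typing_s:
  assumes "cuttable \<Gamma> M A" "finite \<Gamma>"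
  shows "\<Gamma> \<turnstile>\<^sub>s M : A"
proof -
  obtain y where "y \<notin> fst ` \<Gamma>" using assms(2) by (rule_tac X = "fst ` \<Gamma>" in ex_fresh_var) auto
  then show ?thesis
    \<comment> \<open>With the empty spine the cut is made into an axiom.\<close>
    using cuttableD[OF assms(1) subset_refl, of y "[]"] Ax_s[OF assms(2)] by auto
qed

lemma cuttable_App:
  assumes M: "cuttable \<Gamma> M (A \<rightarrow>\<^sub>t B)" and N: "\<Gamma> \<turnstile>\<^sub>s N : A"
  shows "cuttable \<Gamma> (App M N) B"
  unfolding cuttable_def
proof (intro allI impI)
  fix \<Delta> Ns y C
  assume sub: "\<Gamma> \<subseteq> \<Delta>" and y: "y \<notin> (\<Union>N\<in>set Ns. FV N)" "y \<notin> fst ` \<Delta>"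
    and d: "insert (y, B) \<Delta> \<turnstile>\<^sub>s Apps (Var y) Ns : C"
  have fin: "finite \<Delta>" using typing_s_ctx[OF d] by simp
  then obtain z where z: "z \<notin> fst ` \<Delta> \<union> (\<Union>N\<in>set (N # Ns). FV N)"
    by (rule_tac X = "fst ` \<Delta> \<union> (\<Union>N\<in>set (N # Ns). FV N)" in ex_fresh_var) auto
  \<comment> \<open>\<open>L_Arr\<close> trades the head \<open>y\<close> of type \<open>B\<close>
    for a head \<open>z\<close> of arrow type with \<open>N\<close> as an additional first argument;
    \<open>z\<close> must therefore avoid \<open>N\<close> too.\<close>
  have "insert (z, A \<rightarrow>\<^sub>t B) \<Delta> \<turnstile>\<^sub>s Apps (Var z) (N # Ns) : C"
    unfolding Apps_Cons by (rule L_Arr[OF typing_s_weaken[OF N sub fin] d y])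
  then show "\<Delta> \<turnstile>\<^sub>s Apps (App M N) Ns : C"
    using cuttableD[OF M sub] z unfolding Apps_Cons[symmetric] by blast
qed

lemma cuttable_Inter:
  assumes M: "cuttable \<Gamma> M (A \<inter>\<^sub>t B)" and C: "C = A \<or> C = B"
  shows "cuttable \<Gamma> M C"
  unfolding cuttable_def
proof (intro allI impI)
  fix \<Delta> Ns y D
  assume sub: "\<Gamma> \<subseteq> \<Delta>" and y: "y \<notin> (\<Union>N\<in>set Ns. FV N)" "y \<notin> fst ` \<Delta>"
    and d: "insert (y, C) \<Delta> \<turnstile>\<^sub>s Apps (Var y) Ns : D"
  \<comment> \<open>Weakening gives \<open>y\<close> both component types, as the premise of
    \<open>L_Int\<close> demands.\<close>
  have "insert (y, A) (insert (y, B) \<Delta>) \<turnstile>\<^sub>s Apps (Var y) Ns : D"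
    using typing_s_ctx[OF d] C by (intro typing_s_weaken[OF d]) auto
  then show "\<Delta> \<turnstile>\<^sub>s Apps M Ns : D"
    by (rule cuttableD[OF M sub L_Int y])
qed


section \<open>Computability\<close>

primrec computable :: "'a ty \<Rightarrow> 'a ctx \<Rightarrow> lterm \<Rightarrow> bool" where
  "computable (Atom a) \<Gamma> M \<longleftrightarrow> \<Gamma> \<turnstile>\<^sub>s M : Atom a"
| "computable (A \<rightarrow>\<^sub>t B) \<Gamma> M \<longleftrightarrow> \<Gamma> \<turnstile>\<^sub>s M : A \<rightarrow>\<^sub>t B \<and>
    (\<forall>\<Delta> N. \<Gamma> \<subseteq> \<Delta> \<longrightarrow> finite \<Delta> \<longrightarrow> computable A \<Delta> N \<longrightarrow> computable B \<Delta> (App M N))"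
| "computable (A \<inter>\<^sub>t B) \<Gamma> M \<longleftrightarrow> computable A \<Gamma> M \<and> computable B \<Gamma> M"

lemma computable_typing_s: "computable A \<Gamma> M \<Longrightarrow> \<Gamma> \<turnstile>\<^sub>s M : A"
  by (induction A) (auto intro: R_Int)

lemma computable_mono: "computable A \<Gamma> M \<Longrightarrow> \<Gamma> \<subseteq> \<Delta> \<Longrightarrow> finite \<Delta> \<Longrightarrow> computable A \<Delta> M"
  by (induction A) (auto intro: typing_s_weaken)

text \<open>In the arrow case the argument contributes only its typing, by
  \<open>computable_typing_s\<close>. Since the arrow clause contains typability, that lemma stands
  alone and no simultaneous induction is needed.\<close>

lemma cuttable_computable: "cuttable \<Gamma> M A \<Longrightarrow> finite \<Gamma> \<Longrightarrow> computable A \<Gamma> M"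
proof (induction A arbitrary: \<Gamma> M)
  case (Atom a)
  then show ?case by (simp add: cuttable_typing_s)
next
  case (Arrow A B)
  have "computable B \<Delta> (App M N)"
    if "\<Gamma> \<subseteq> \<Delta>" "finite \<Delta>" "computable A \<Delta> N" for \<Delta> N
    using cuttable_App[OF cuttable_mono[OF Arrow.prems(1) that(1)] computable_typing_s[OF that(3)]]
      that(2) by (rule Arrow.IH(2))
  with Arrow.prems show ?case by (simp add: cuttable_typing_s)
next
  case (Inter A B)
  have "cuttable \<Gamma> M A" "cuttable \<Gamma> M B"
    using cuttable_Inter[OF Inter.prems(1)] by simp_all
  with Inter show ?case by simp
qed

text \<open>The spine \<open>Ns\<close> is general because the arrow case appends the new argument
  \<open>P\<close> to it; \<open>Beta_s\<close> admits spines of any length.\<close>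

lemma computable_beta:
  "computable A \<Gamma> (Apps (M[x ::= N]) Ns) \<Longrightarrow> \<Gamma> \<turnstile>\<^sub>s N : B \<Longrightarrow>
    computable A \<Gamma> (Apps (App (Lam x M) N) Ns)"
proof (induction A arbitrary: \<Gamma> Ns)
  case (Atom a)
  then show ?case by (auto intro: Beta_s)
next
  case (Arrow A C)
  have "computable C \<Delta> (App (Apps (App (Lam x M) N) Ns) P)"
    if "\<Gamma> \<subseteq> \<Delta>" "finite \<Delta>" "computable A \<Delta> P" for \<Delta> P
    unfolding Apps_snoc[symmetric]
    using that Arrow.prems(1) typing_s_weaken[OF Arrow.prems(2) that(1,2)]
    by (intro Arrow.IH(2)) (auto simp: Apps_snoc)
  moreover have "\<Gamma> \<turnstile>\<^sub>s Apps (App (Lam x M) N) Ns : A \<rightarrow>\<^sub>t C"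
    using Arrow.prems by (intro Beta_s) auto
  ultimately show ?case by simp
next
  case (Inter A C)
  then show ?case by auto
qed

text \<open>Fundamental lemma of the computability argument. Generality in \<sigma> and \<Delta> is
  what the abstraction case needs.\<close>

lemma typing_computable:
  assumes "\<Gamma> \<turnstile> M : A" "finite \<Delta>" "\<And>x B. (x, B) \<in> \<Gamma> \<Longrightarrow> computable B \<Delta> (\<sigma> x)"
  shows "computable A \<Delta> (msubst \<sigma> M)"
  using assms
proof (induction arbitrary: \<Delta> \<sigma> rule: typing.induct)
  case (ArrI x A \<Gamma> M B)
  have "finite (fst ` \<Delta>)" using ArrI.prems by simp
  then obtain z where z: "z \<notin> fst ` \<Delta>" "msubst \<sigma> (Lam x M) = Lam z (msubst (\<sigma>(x := Var z)) M)"
    "\<And>N. (msubst (\<sigma>(x := Var z)) M)[z ::= N] = msubst (\<sigma>(x := N)) M"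
    by (rule msubst_Lam_fresh) blast
  \<comment> \<open>Used twice: with \<open>Var z\<close> in the context extended by
    \<open>z\<close>, to type the abstraction by \<open>R_Arr\<close>, and with an arbitrary
    computable \<open>N\<close>, as the reduct for \<open>computable_beta\<close>.\<close>
  have body: "computable B \<Delta>' (msubst (\<sigma>(x := N)) M)"
    if "\<Delta> \<subseteq> \<Delta>'" "finite \<Delta>'" "computable A \<Delta>' N" for \<Delta>' N
    using that ArrI.prems ArrI.hyps(2)
    by (intro ArrI.IH) (auto simp: image_iff intro: computable_mono)
  have "computable A (insert (z, A) \<Delta>) (Var z)"
    using ArrI.prems by (intro cuttable_computable cuttable_Var) auto
  then have "insert (z, A) \<Delta> \<turnstile>\<^sub>s msubst (\<sigma>(x := Var z)) M : B"
    using ArrI.prems by (intro computable_typing_s body) auto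
  then have "\<Delta> \<turnstile>\<^sub>s Lam z (msubst (\<sigma>(x := Var z)) M) : A \<rightarrow>\<^sub>t B"
    using z(1) by (rule R_Arr)
  moreover have "computable B \<Delta>' (App (Lam z (msubst (\<sigma>(x := Var z)) M)) N)"
    if "\<Delta> \<subseteq> \<Delta>'" "finite \<Delta>'" "computable A \<Delta>' N" for \<Delta>' N
    using computable_beta[of B \<Delta>' _ z N "[]"] body[OF that] computable_typing_s[OF that(3)]
    by (simp add: z(3))
  ultimately show ?case unfolding z(2) by simp
next
  case (ArrE \<Gamma> M A B N)
  have "computable (A \<rightarrow>\<^sub>t B) \<Delta> (msubst \<sigma> M)" "computable A \<Delta> (msubst \<sigma> N)"
    using ArrE by blast+
  then show ?case using ArrE.prems(1) by simp
next
  case (IntE1 \<Gamma> M A B)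
  then have "computable (A \<inter>\<^sub>t B) \<Delta> (msubst \<sigma> M)" by blast
  then show ?case by simp
next
  case (IntE2 \<Gamma> M A B)
  then have "computable (A \<inter>\<^sub>t B) \<Delta> (msubst \<sigma> M)" by blast
  then show ?case by simp
qed simp_all

theorem theorem2:
  fixes \<Gamma> :: "'a ctx" and M :: lterm and A :: "'a ty"
  assumes "\<Gamma> \<turnstile> M : A"
  shows "\<Gamma> \<turnstile>\<^sub>s M : A"
proof -
  have fin: "finite \<Gamma>" using typing_ctx[OF assms] by simp
  \<comment> \<open>The identity substitution is computable, since each declared variable is
    cuttable at its type.\<close>
  have "computable A \<Gamma> (msubst Var M)"
    using fin by (intro typing_computable[OF assms] cuttable_computable cuttable_Var)
  then show ?thesis by (simp add: msubst_id computable_typing_s)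
qed

end
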